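(* Let $a\in\mathbb{R}$, $a\neq0$, and let $n\ge1$. Consider the systems $$\dot{x}=-y(x+a)^2+\varepsilon f(x,y),\qquad \dot{y}=x(x+a)^2+\varepsilon g(x,y),$$ with $0<|\varepsilon|\ll1$ and $f,g$ arbitrary real polynomials of degree $n$. Then the maximum number of limit cycles, given by the first order averaging function in $\varepsilon$, bifurcating from the period annulus surrounding the origin of the unperturbed system ($\varepsilon=0$), over all such $f$ and $g$, is exactly $n$.
   Context: The perturbations are $f(x,y)=\sum_{i+j=0}^n a_{i,j}x^iy^j$, $g(x,y)=\sum_{i+j=0}^n b_{i,j}x^iy^j$ with arbitrary real coefficients (total degree at most $n$). The unperturbed system has the first integral $x^2+y^2$, and the period annulus surrounding the origin consists of the circles $x^2+y^2=r^2$, $0<r<|a|$. In polar coordinates $x=r\cos\theta$, $y=r\sin\theta$, the first order averaged function is $$f^0(r)=\int_0^{2\pi}\frac{f(r\cos\theta,r\sin\theta)\cos\theta+g(r\cos\theta,r\sin\theta)\sin\theta}{(r\cos\theta+a)^2}\,d\theta,\qquad r\in(0,|a|).$$ The number of limit cycles given by the first order averaging function is the number of simple zeros of $f^0$ in $(0,|a|)$. *)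

theory Defs
  imports "HOL-Analysis.Analysis"
begin

text \<open>Real polynomial functions in two variables of total degree at most \<open>n\<close>.\<close>

definition poly2_le :: "nat \<Rightarrow> (real \<Rightarrow> real \<Rightarrow> real) set" where
  "poly2_le n = {f. \<exists>c :: nat \<Rightarrow> nat \<Rightarrow> real.
     f = (\<lambda>x y. \<Sum>i\<le>n. \<Sum>j\<le>n - i. c i j * x ^ i * y ^ j)}"

definition averaged_fun ::
  "real \<Rightarrow> (real \<Rightarrow> real \<Rightarrow> real) \<Rightarrow> (real \<Rightarrow> real \<Rightarrow> real) \<Rightarrow> real \<Rightarrow> real" where
  "averaged_fun a f g r = integral {0..2 * pi} (\<lambda>\<theta>.
     (f (r * cos \<theta>) (r * sin \<theta>) * cos \<theta> + g (r * cos \<theta>) (r * sin \<theta>) * sin \<theta>)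
       / (r * cos \<theta> + a)\<^sup>2)"

definition simple_zero :: "(real \<Rightarrow> real) \<Rightarrow> real \<Rightarrow> bool" where
  "simple_zero F r \<longleftrightarrow> F r = 0 \<and> (\<exists>D. (F has_real_derivative D) (at r) \<and> D \<noteq> 0)"

text \<open>
  Radii of the periodic orbits \<open>x\<^sup>2 + y\<^sup>2 = r\<^sup>2\<close> of the unperturbed annulus from which, according
  to the first order averaging function, a limit cycle bifurcates.
\<close>

definition averaging_limit_cycles ::
  "real \<Rightarrow> (real \<Rightarrow> real \<Rightarrow> real) \<Rightarrow> (real \<Rightarrow> real \<Rightarrow> real) \<Rightarrow> real set" where
  "averaging_limit_cycles a f g = {r \<in> {0<..<\<bar>a\<bar>}. simple_zero (averaged_fun a f g) r}"

text \<open>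
  The perturbed system, as the pair \<open>(x', y')\<close>, and the slope \<open>dr/d\<theta> = r' / \<theta>'\<close> of its orbits in
  polar coordinates, where \<open>r' = (x x' + y y') / r\<close> and \<open>\<theta>' = (x y' - y x') / r\<^sup>2\<close>.  They do not
  enter the definitions above; \<open>polar_slope_first_order\<close> shows that the integrand in
  \<open>averaged_fun\<close> is the coefficient of \<open>\<epsilon>\<close> in \<open>dr/d\<theta>\<close>.
\<close>

definition perturbed_field ::
  "real \<Rightarrow> (real \<Rightarrow> real \<Rightarrow> real) \<Rightarrow> (real \<Rightarrow> real \<Rightarrow> real) \<Rightarrow> real \<Rightarrow> real \<times> real \<Rightarrow> real \<times> real" where
  "perturbed_field a f g \<epsilon> = (\<lambda>(x, y).
     (- y * (x + a)\<^sup>2 + \<epsilon> * f x y, x * (x + a)\<^sup>2 + \<epsilon> * g x y))"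

definition polar_slope :: "(real \<times> real \<Rightarrow> real \<times> real) \<Rightarrow> real \<Rightarrow> real \<Rightarrow> real" where
  "polar_slope X \<theta> r =
     (let x = r * cos \<theta>; y = r * sin \<theta>; (x', y') = X (x, y)
      in ((x * x' + y * y') / r) / ((x * y' - y * x') / r\<^sup>2))"

lemma polar_slope_first_order:
  assumes "0 < r" "r < \<bar>a\<bar>"
  shows "polar_slope (perturbed_field a f g 0) \<theta> r = 0"
    and "((\<lambda>\<epsilon>. polar_slope (perturbed_field a f g \<epsilon>) \<theta> r) has_real_derivative
       (f (r * cos \<theta>) (r * sin \<theta>) * cos \<theta> + g (r * cos \<theta>) (r * sin \<theta>) * sin \<theta>)
         / (r * cos \<theta> + a)\<^sup>2) (at 0)"
proof -
  define u where "u = f (r * cos \<theta>) (r * sin \<theta>)"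
  define v where "v = g (r * cos \<theta>) (r * sin \<theta>)"
  define w where "w = (r * cos \<theta> + a)\<^sup>2"
  have "\<bar>r * cos \<theta>\<bar> \<le> r * 1"
    unfolding abs_mult using assms abs_cos_le_one[of \<theta>] by (intro mult_mono) auto
  then have w: "w \<noteq> 0"
    using assms by (auto simp: w_def)
  have sq: "(cos \<theta>)\<^sup>2 + (sin \<theta>)\<^sup>2 = 1"
    by simp
  have eq: "polar_slope (perturbed_field a f g \<epsilon>) \<theta> r =
      \<epsilon> * (u * cos \<theta> + v * sin \<theta>) / (w + \<epsilon> * (v * cos \<theta> - u * sin \<theta>) / r)" for \<epsilon>
  proof -
    have "polar_slope (perturbed_field a f g \<epsilon>) \<theta> r =
        ((r * cos \<theta> * (- (r * sin \<theta>) * w + \<epsilon> * u) + r * sin \<theta> * (r * cos \<theta> * w + \<epsilon> * v)) / r)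
        / ((r * cos \<theta> * (r * cos \<theta> * w + \<epsilon> * v) - r * sin \<theta> * (- (r * sin \<theta>) * w + \<epsilon> * u)) / r\<^sup>2)"
      by (simp add: polar_slope_def perturbed_field_def Let_def u_def v_def w_def)
    also have "r * cos \<theta> * (- (r * sin \<theta>) * w + \<epsilon> * u) + r * sin \<theta> * (r * cos \<theta> * w + \<epsilon> * v)
        = r * (\<epsilon> * (u * cos \<theta> + v * sin \<theta>))"
      by (simp add: algebra_simps)
    also have "r * cos \<theta> * (r * cos \<theta> * w + \<epsilon> * v) - r * sin \<theta> * (- (r * sin \<theta>) * w + \<epsilon> * u)
        = r\<^sup>2 * w + r * (\<epsilon> * (v * cos \<theta> - u * sin \<theta>))"
      using sq by algebra
    also have "(r\<^sup>2 * w + r * (\<epsilon> * (v * cos \<theta> - u * sin \<theta>))) / r\<^sup>2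
        = w + \<epsilon> * (v * cos \<theta> - u * sin \<theta>) / r"
      using assms by (simp add: field_simps power2_eq_square)
    finally show ?thesis
      using assms by simp
  qed
  show "polar_slope (perturbed_field a f g 0) \<theta> r = 0"
    by (simp add: eq)
  show "((\<lambda>\<epsilon>. polar_slope (perturbed_field a f g \<epsilon>) \<theta> r) has_real_derivative
       (f (r * cos \<theta>) (r * sin \<theta>) * cos \<theta> + g (r * cos \<theta>) (r * sin \<theta>) * sin \<theta>)
         / (r * cos \<theta> + a)\<^sup>2) (at 0)"
    unfolding eq u_def[symmetric] v_def[symmetric] w_def[symmetric]
    using w assms by (auto intro!: derivative_eq_intros simp: field_simps)
qed

end

theory Submission
  imports Defs
begin

text \<open>
  In the variable \<open>S = sgn a * sqrt (a\<^sup>2 - r\<^sup>2)\<close> the averaged function takes the form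
  \<open>r * f\<^sup>0(r) = P(S) / S ^ 3\<close> with a polynomial \<open>P\<close> of degree at most \<open>n + 2\<close> that has no linear term,
  and \<open>r = 0\<close> gives \<open>P(a) = 0\<close>.  If \<open>P\<close> had \<open>n + 2\<close> distinct roots \<open>z\<close> of the sign of \<open>a\<close>, its linear
  coefficient would be a nonzero multiple of \<open>\<Sum> 1/z\<close>, which cannot vanish; discarding the root \<open>a\<close>
  leaves at most \<open>n\<close> zeros.  Conversely the perturbations \<open>f = (x\<^sup>2 + y\<^sup>2) ^ k\<close> and
  \<open>f = x * (x\<^sup>2 + y\<^sup>2) ^ k\<close>, \<open>g = 0\<close>, yield such polynomials of every degree \<open>2, \<dots>, n + 2\<close>, so every
  such \<open>P\<close> occurs, in particular one with \<open>n\<close> simple roots strictly between \<open>0\<close> and \<open>a\<close>, the root \<open>a\<close>,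
  and a last root of the opposite sign chosen to kill the linear term.
\<close>

section \<open>The signed leg and the two elementary integrals over a circle\<close>

text \<open>The sign makes all integral formulas below uniform in \<open>a > 0\<close> and \<open>a < 0\<close>.\<close>

definition signed_leg :: "real \<Rightarrow> real \<Rightarrow> real" where
  "signed_leg a r = sgn a * sqrt (a\<^sup>2 - r\<^sup>2)"

lemma signed_leg_zero [simp]: "signed_leg a 0 = a"
  by (simp add: signed_leg_def real_sgn_eq)

context
  fixes a r :: real
  assumes r: "\<bar>r\<bar> < \<bar>a\<bar>"
begin

lemma sq_diff_pos: "a\<^sup>2 - r\<^sup>2 > 0"
  using r by (simp add: abs_square_less_1 power2_strict_mono)

lemma signed_leg_sq: "(signed_leg a r)\<^sup>2 = a\<^sup>2 - r\<^sup>2"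
  using sq_diff_pos r by (auto simp: signed_leg_def power_mult_distrib sgn_if)

lemma signed_leg_same_sign: "signed_leg a r * a > 0"
  using sq_diff_pos r by (auto simp: signed_leg_def sgn_if mult_pos_neg)

lemma signed_leg_nonzero: "signed_leg a r \<noteq> 0"
  using signed_leg_same_sign by auto

lemma denominator_nonzero: "r * cos \<theta> + a \<noteq> 0"
proof -
  have "\<bar>r * cos \<theta>\<bar> \<le> \<bar>r\<bar> * 1"
    unfolding abs_mult by (intro mult_mono) auto
  then show ?thesis
    using r by linarith
qed

text \<open>\<open>signed_leg a r\<close> has the sign of \<open>a\<close>, so adding it only
  increases the distance from zero beyond \<bar>a\<bar> > \<bar>r\<bar>. This is the denominator in
  the arctan of the next proof.\<close>

lemma shifted_denominator_nonzero: "a + signed_leg a r + r * cos \<theta> \<noteq> 0"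
proof -
  have "\<bar>r * cos \<theta>\<bar> \<le> \<bar>r\<bar> * 1"
    unfolding abs_mult by (intro mult_mono) auto
  then show ?thesis
    using r signed_leg_same_sign by (auto simp: zero_less_mult_iff abs_if split: if_splits)
qed

text \<open>An explicit primitive exists on the whole period. Its arctan term vanishes at both
  endpoints, where sin is 0, so only \<theta> / S contributes.\<close>

lemma has_integral_inverse_denominator:
  "((\<lambda>\<theta>. 1 / (r * cos \<theta> + a)) has_integral 2 * pi / signed_leg a r) {0..2 * pi}"
proof -
  define S where "S = signed_leg a r"
  \<comment> \<open>Unlike the half-angle substitution, this primitive has no jump at \<open>\<theta> = pi\<close>.\<close>
  define F where "F \<theta> = (\<theta> - 2 * arctan (r * sin \<theta> / (a + S + r * cos \<theta>))) / S" for \<theta>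
  have S: "S \<noteq> 0" "S\<^sup>2 = a\<^sup>2 - r\<^sup>2"
    using signed_leg_nonzero signed_leg_sq by (auto simp: S_def)
  have aS: "a + S \<noteq> 0"
    using shifted_denominator_nonzero[of "pi / 2"] by (simp add: S_def)
  have "(F has_real_derivative 1 / (r * cos \<theta> + a)) (at \<theta>)" for \<theta>
  proof -
    define x y where "x = r * cos \<theta>" and "y = r * sin \<theta>"
    define u where "u = a + S + x"
    have u: "u \<noteq> 0" "x + a \<noteq> 0"
      using shifted_denominator_nonzero denominator_nonzero by (auto simp: u_def S_def x_def)
    have xy: "x\<^sup>2 + y\<^sup>2 = r\<^sup>2"
      using sin_cos_squared_add2[of \<theta>] unfolding x_def y_def by algebra
    \<comment> \<open>This factorization makes the primitive work: the numerator of the derivative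
      will turn out to be 2 * (a + S) * S, so that a + S cancels and x + a remains below.\<close>
    have sum: "u\<^sup>2 + y\<^sup>2 = 2 * (a + S) * (x + a)"
      unfolding u_def using xy S(2) by algebra
    have D: "((\<lambda>\<theta>. r * sin \<theta> / (a + S + r * cos \<theta>)) has_real_derivative (x * u + y\<^sup>2) / u\<^sup>2) (at \<theta>)"
      using u(1) unfolding u_def x_def y_def
      by (auto intro!: derivative_eq_intros simp: power2_eq_square)
    have "(F has_real_derivative (1 - 2 * (inverse (1 + (y / u)\<^sup>2) * ((x * u + y\<^sup>2) / u\<^sup>2))) / S) (at \<theta>)"
      using DERIV_cdivide[OF DERIV_diff[OF DERIV_ident
            DERIV_cmult[OF DERIV_chain2[OF DERIV_arctan D], of 2]], of S]
      unfolding F_def by (simp add: x_def y_def u_def)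
    moreover have "inverse (1 + (y / u)\<^sup>2) * ((x * u + y\<^sup>2) / u\<^sup>2) = (x * u + y\<^sup>2) / (u\<^sup>2 + y\<^sup>2)"
    proof -
      have "1 + (y / u)\<^sup>2 = (u\<^sup>2 + y\<^sup>2) / u\<^sup>2"
        using u by (simp add: power_divide add_divide_distrib)
      then show ?thesis
        using u by simp
    qed
    moreover have "(1 - 2 * ((x * u + y\<^sup>2) / (u\<^sup>2 + y\<^sup>2))) / S = 1 / (x + a)"
    proof -
      have "u\<^sup>2 + y\<^sup>2 - 2 * (x * u + y\<^sup>2) = 2 * (a + S) * S"
        unfolding u_def using xy S(2) by algebra
      moreover have "u\<^sup>2 + y\<^sup>2 \<noteq> 0"
        using u aS unfolding sum by simp
      then have "1 - 2 * ((x * u + y\<^sup>2) / (u\<^sup>2 + y\<^sup>2))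
          = (u\<^sup>2 + y\<^sup>2 - 2 * (x * u + y\<^sup>2)) / (u\<^sup>2 + y\<^sup>2)"
        by (simp only: diff_divide_distrib divide_self) simp
      ultimately have "1 - 2 * ((x * u + y\<^sup>2) / (u\<^sup>2 + y\<^sup>2)) = 2 * (a + S) * S / (2 * (a + S) * (x + a))"
        by (simp only: sum)
      then show ?thesis
        using S u aS by simp
    qed
    ultimately show ?thesis
      by (simp only: x_def)
  qed
  then have "((\<lambda>\<theta>. 1 / (r * cos \<theta> + a)) has_integral F (2 * pi) - F 0) {0..2 * pi}"
    by (intro fundamental_theorem_of_calculus)
      (auto simp: has_real_derivative_iff_has_vector_derivative[symmetric] intro: DERIV_subset)
  then show ?thesis
    by (simp add: F_def S_def)
qed

text \<open>The function r sin \<theta> / (r cos \<theta> + a) takes the same value at both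
  endpoints, so its derivative integrates to 0. That derivative combines the first and second
  inverse powers of the denominator, which expresses the new integral by the previous one.\<close>

lemma has_integral_inverse_denominator_sq:
  "((\<lambda>\<theta>. 1 / (r * cos \<theta> + a)\<^sup>2) has_integral 2 * pi * a / (signed_leg a r) ^ 3) {0..2 * pi}"
proof -
  define S where "S = signed_leg a r"
  define F where "F \<theta> = r * sin \<theta> / (r * cos \<theta> + a)" for \<theta>
  have S: "S \<noteq> 0" "S\<^sup>2 = a\<^sup>2 - r\<^sup>2"
    using signed_leg_nonzero signed_leg_sq by (auto simp: S_def)
  have F: "(F has_real_derivative a * (1 / (r * cos \<theta> + a)) - S\<^sup>2 * (1 / (r * cos \<theta> + a)\<^sup>2)) (at \<theta>)" for \<theta>
  proof -
    define x y u where "x = r * cos \<theta>" and "y = r * sin \<theta>" and "u = r * cos \<theta> + a"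
    have u: "u \<noteq> 0"
      using denominator_nonzero by (simp add: u_def)
    have xy: "x\<^sup>2 + y\<^sup>2 = r\<^sup>2"
      using sin_cos_squared_add2[of \<theta>] unfolding x_def y_def by algebra
    have "(F has_real_derivative (x * u + y\<^sup>2) / u\<^sup>2) (at \<theta>)"
      using u unfolding u_def x_def y_def F_def
      by (auto intro!: derivative_eq_intros simp: power2_eq_square)
    moreover have "x * u + y\<^sup>2 = a * u - S\<^sup>2"
      unfolding S(2) xy[symmetric] by (simp add: u_def x_def algebra_simps power2_eq_square)
    moreover have "(a * u - S\<^sup>2) / u\<^sup>2 = a * (1 / u) - S\<^sup>2 * (1 / u\<^sup>2)"
      using u by (simp add: field_simps power2_eq_square)
    ultimately show ?thesis
      by (simp add: u_def)
  qed
  have "((\<lambda>\<theta>. a * (1 / (r * cos \<theta> + a)) - S\<^sup>2 * (1 / (r * cos \<theta> + a)\<^sup>2)) has_integral F (2 * pi) - F 0) {0..2 * pi}"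
    using F by (intro fundamental_theorem_of_calculus)
      (auto simp: has_real_derivative_iff_has_vector_derivative[symmetric] intro: DERIV_subset)
  from has_integral_diff[OF has_integral_mult_right[OF has_integral_inverse_denominator, of a] this]
  have "((\<lambda>\<theta>. S\<^sup>2 * (1 / (r * cos \<theta> + a)\<^sup>2)) has_integral a * (2 * pi / S)) {0..2 * pi}"
    by (simp add: F_def S_def)
  from has_integral_mult_right[OF this, of "1 / S\<^sup>2"] show ?thesis
    using S(1) by (simp add: S_def field_simps power2_eq_square power3_eq_cube)
qed

end

section \<open>Moments of monomials on the circle and their recurrences\<close>

text \<open>With x = r cos \<theta> and y = r sin \<theta> this is the integral of x^p y^q / (x +
  a)^2. Keeping the powers of r inside makes \<open>r * averaged_fun a f g r\<close> a combination
  of moments with coefficients independent of r.\<close>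

definition trig_moment :: "real \<Rightarrow> nat \<Rightarrow> nat \<Rightarrow> real \<Rightarrow> real" where
  "trig_moment a p q r =
     integral {0..2 * pi} (\<lambda>\<theta>. (r * cos \<theta>) ^ p * (r * sin \<theta>) ^ q / (r * cos \<theta> + a)\<^sup>2)"

lemma integrable_over_denominator_sq:
  assumes "\<bar>r\<bar> < \<bar>a\<bar>" and "continuous_on {0..2 * pi} h"
  shows "(\<lambda>\<theta>. h \<theta> / (r * cos \<theta> + a)\<^sup>2) integrable_on {0..2 * pi}"
  using assms denominator_nonzero[of r a]
  by (intro integrable_continuous_interval continuous_intros) auto

lemma trig_moment_integrable:
  assumes "\<bar>r\<bar> < \<bar>a\<bar>"
  shows "(\<lambda>\<theta>. (r * cos \<theta>) ^ p * (r * sin \<theta>) ^ q / (r * cos \<theta> + a)\<^sup>2) integrable_on {0..2 * pi}"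
  by (intro integrable_over_denominator_sq assms continuous_intros)

text \<open>Descent by two: cos^(j+1) sin vanishes at both endpoints, and its derivative is a
  combination of cos^(j+2) and cos^j.\<close>

lemma integral_cos_power_odd:
  assumes "odd k"
  shows "integral {0..2 * pi} (\<lambda>\<theta>. cos \<theta> ^ k) = (0::real)"
proof -
  obtain m where k: "k = 2 * m + 1"
    using assms oddE by blast
  have "((\<lambda>\<theta>. cos \<theta> ^ (2 * m + 1)) has_integral (0::real)) {0..2 * pi}"
  proof (induction m)
    case 0
    have "((\<lambda>\<theta>. cos \<theta>) has_integral sin (2 * pi) - sin 0) {0..2 * pi}"
      by (intro fundamental_theorem_of_calculus)
        (auto simp: has_real_derivative_iff_has_vector_derivative[symmetric] intro!: derivative_eq_intros)
    then show ?case by simp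
  next
    case (Suc m)
    define j where "j = 2 * m + 1"
    define F where "F \<theta> = cos \<theta> ^ (j + 1) * sin \<theta>" for \<theta> :: real
    have "(F has_real_derivative real (j + 2) * cos \<theta> ^ (j + 2) - real (j + 1) * cos \<theta> ^ j) (at \<theta>)" for \<theta>
    proof -
      have "(F has_real_derivative real (j + 1) * cos \<theta> ^ j * (- sin \<theta>) * sin \<theta> + cos \<theta> ^ (j + 1) * cos \<theta>) (at \<theta>)"
        unfolding F_def by (rule derivative_eq_intros refl | simp)+
      moreover have "real (j + 1) * cos \<theta> ^ j * (- sin \<theta>) * sin \<theta> + cos \<theta> ^ (j + 1) * cos \<theta>
          = cos \<theta> ^ (j + 2) - real (j + 1) * cos \<theta> ^ j * (sin \<theta>)\<^sup>2"
        by (simp add: power2_eq_square)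
      moreover have "\<dots> = real (j + 2) * cos \<theta> ^ (j + 2) - real (j + 1) * cos \<theta> ^ j"
        unfolding sin_squared_eq by (simp add: power2_eq_square algebra_simps)
      ultimately show ?thesis
        by (simp only:)
    qed
    then have "((\<lambda>\<theta>. real (j + 2) * cos \<theta> ^ (j + 2) - real (j + 1) * cos \<theta> ^ j) has_integral
        F (2 * pi) - F 0) {0..2 * pi}"
      by (intro fundamental_theorem_of_calculus)
        (auto simp: has_real_derivative_iff_has_vector_derivative[symmetric] intro: DERIV_subset)
    from has_integral_add[OF this has_integral_mult_right[OF Suc, of "real (j + 1)"]]
    have "((\<lambda>\<theta>. real (j + 2) * cos \<theta> ^ (j + 2)) has_integral (0::real)) {0..2 * pi}"
      by (simp add: F_def j_def)
    from has_integral_mult_right[OF this, of "1 / real (j + 2)"] show ?case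
      by (simp add: j_def)
  qed
  then show ?thesis
    by (simp add: k integral_unique)
qed

text \<open>The integrand is odd and has period 2 pi: reflection changes the sign of the integral,
  while a shift by one period brings the interval back.\<close>

lemma trig_moment_odd_sin:
  assumes "odd q"
  shows "trig_moment a p q r = 0"
proof -
  define h where "h \<theta> = (r * cos \<theta>) ^ p * (r * sin \<theta>) ^ q / (r * cos \<theta> + a)\<^sup>2" for \<theta>
  have odd: "h (- \<theta>) = - h \<theta>" for \<theta>
    using assms by (simp add: h_def)
  have per: "h (\<theta> + 2 * pi) = h \<theta>" for \<theta>
    by (simp add: h_def)
  have "integral {0..2 * pi} h = integral {- (2 * pi)..0} (\<lambda>\<theta>. h (- \<theta>))"
    using Henstock_Kurzweil_Integration.integral_reflect_real[of "2 * pi" 0 h]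
    by (simp only: minus_zero)
  also have "\<dots> = - integral {- (2 * pi)..0} h"
    by (simp add: odd)
  also have "integral {- (2 * pi)..0} h = integral {0..2 * pi} h"
    using integral_shift_real_ivl[of 0 "2 * pi" "2 * pi" h] by (simp add: per)
  finally have "integral {0..2 * pi} h = 0"
    by simp
  then show ?thesis
    by (simp add: trig_moment_def h_def [abs_def])
qed

lemma trig_moment_has_integral:
  assumes "\<bar>r\<bar> < \<bar>a\<bar>"
  shows "((\<lambda>\<theta>. (r * cos \<theta>) ^ p * (r * sin \<theta>) ^ q / (r * cos \<theta> + a)\<^sup>2)
           has_integral trig_moment a p q r) {0..2 * pi}"
  unfolding trig_moment_def by (intro integrable_integral trig_moment_integrable assms)

lemma trig_moment_0_0:
  assumes "\<bar>r\<bar> < \<bar>a\<bar>"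
  shows "trig_moment a 0 0 r = 2 * pi * a / signed_leg a r ^ 3"
  unfolding trig_moment_def using integral_unique[OF has_integral_inverse_denominator_sq[OF assms]] by simp

text \<open>Writing x = (x + a) - a reduces the moment to the two elementary integrals.\<close>

lemma trig_moment_1_0:
  assumes r: "\<bar>r\<bar> < \<bar>a\<bar>"
  shows "trig_moment a 1 0 r = 2 * pi * ((signed_leg a r)\<^sup>2 - a\<^sup>2) / signed_leg a r ^ 3"
proof -
  have "((\<lambda>\<theta>. 1 / (r * cos \<theta> + a) - a * (1 / (r * cos \<theta> + a)\<^sup>2)) has_integral
      2 * pi / signed_leg a r - a * (2 * pi * a / signed_leg a r ^ 3)) {0..2 * pi}"
    by (intro has_integral_diff has_integral_mult_right has_integral_inverse_denominator
        has_integral_inverse_denominator_sq r)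
  moreover have "1 / (r * cos \<theta> + a) - a * (1 / (r * cos \<theta> + a)\<^sup>2) = r * cos \<theta> / (r * cos \<theta> + a)\<^sup>2" for \<theta>
    using denominator_nonzero[OF r, of \<theta>] by (simp add: divide_simps power2_eq_square)
  ultimately have "trig_moment a 1 0 r = 2 * pi / signed_leg a r - a * (2 * pi * a / signed_leg a r ^ 3)"
    by (simp add: trig_moment_def integral_unique)
  also have "\<dots> = 2 * pi * ((signed_leg a r)\<^sup>2 - a\<^sup>2) / signed_leg a r ^ 3"
    using signed_leg_nonzero[OF r] by (simp add: field_simps power2_eq_square power3_eq_cube)
  finally show ?thesis .
qed

text \<open>Expand x^p (x + a)^2 and divide by (x + a)^2: the term of highest degree is expressed by
  lower moments and a plain integral of a cosine power.\<close>

lemma trig_moment_cos_rec: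
  assumes r: "\<bar>r\<bar> < \<bar>a\<bar>"
  shows "trig_moment a (p + 2) 0 r = r ^ p * integral {0..2 * pi} (\<lambda>\<theta>. cos \<theta> ^ p)
           - 2 * a * trig_moment a (p + 1) 0 r - a\<^sup>2 * trig_moment a p 0 r"
proof -
  have "((\<lambda>\<theta>. r ^ p * cos \<theta> ^ p
            - 2 * a * ((r * cos \<theta>) ^ (p + 1) * (r * sin \<theta>) ^ 0 / (r * cos \<theta> + a)\<^sup>2)
            - a\<^sup>2 * ((r * cos \<theta>) ^ p * (r * sin \<theta>) ^ 0 / (r * cos \<theta> + a)\<^sup>2)) has_integral
         (r ^ p * integral {0..2 * pi} (\<lambda>\<theta>. cos \<theta> ^ p)
           - 2 * a * trig_moment a (p + 1) 0 r - a\<^sup>2 * trig_moment a p 0 r)) {0..2 * pi}"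
    by (intro has_integral_diff has_integral_mult_right trig_moment_has_integral r
        integrable_integral integrable_continuous_interval continuous_intros)
  moreover have "r ^ p * cos \<theta> ^ p
            - 2 * a * ((r * cos \<theta>) ^ (p + 1) * (r * sin \<theta>) ^ 0 / (r * cos \<theta> + a)\<^sup>2)
            - a\<^sup>2 * ((r * cos \<theta>) ^ p * (r * sin \<theta>) ^ 0 / (r * cos \<theta> + a)\<^sup>2)
        = (r * cos \<theta>) ^ (p + 2) * (r * sin \<theta>) ^ 0 / (r * cos \<theta> + a)\<^sup>2" for \<theta>
  proof -
    define x where "x = r * cos \<theta>"
    have "x + a \<noteq> 0"
      using denominator_nonzero[OF r] by (simp add: x_def)
    then have "x ^ p - 2 * a * (x ^ (p + 1) / (x + a)\<^sup>2) - a\<^sup>2 * (x ^ p / (x + a)\<^sup>2)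
        = x ^ (p + 2) / (x + a)\<^sup>2"
      by (simp add: divide_simps) (simp add: power2_eq_square algebra_simps)
    then show ?thesis
      by (simp add: x_def power_mult_distrib)
  qed
  ultimately show ?thesis
    unfolding trig_moment_def by (simp only: integral_unique)
qed

text \<open>On the circle y^2 = r^2 - x^2, which trades two factors y for factors x.\<close>

lemma trig_moment_sin_rec:
  assumes r: "\<bar>r\<bar> < \<bar>a\<bar>"
  shows "trig_moment a p (q + 2) r = r\<^sup>2 * trig_moment a p q r - trig_moment a (p + 2) q r"
proof -
  have "((\<lambda>\<theta>. r\<^sup>2 * ((r * cos \<theta>) ^ p * (r * sin \<theta>) ^ q / (r * cos \<theta> + a)\<^sup>2)
            - (r * cos \<theta>) ^ (p + 2) * (r * sin \<theta>) ^ q / (r * cos \<theta> + a)\<^sup>2) has_integral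
         (r\<^sup>2 * trig_moment a p q r - trig_moment a (p + 2) q r)) {0..2 * pi}"
    by (intro has_integral_diff has_integral_mult_right trig_moment_has_integral r)
  moreover have "r\<^sup>2 * ((r * cos \<theta>) ^ p * (r * sin \<theta>) ^ q / (r * cos \<theta> + a)\<^sup>2)
            - (r * cos \<theta>) ^ (p + 2) * (r * sin \<theta>) ^ q / (r * cos \<theta> + a)\<^sup>2
        = (r * cos \<theta>) ^ p * (r * sin \<theta>) ^ (q + 2) / (r * cos \<theta> + a)\<^sup>2" for \<theta>
  proof -
    define x y where "x = r * cos \<theta>" and "y = r * sin \<theta>"
    have "r\<^sup>2 = x\<^sup>2 + y\<^sup>2"
      using sin_cos_squared_add2[of \<theta>] unfolding x_def y_def by algebra
    then have "r\<^sup>2 * (x ^ p * y ^ q) - x ^ (p + 2) * y ^ q = x ^ p * y ^ (q + 2)"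
      by (simp add: algebra_simps power2_eq_square)
    then show ?thesis
      unfolding x_def[symmetric] y_def[symmetric] by (metis times_divide_eq_right diff_divide_distrib)
  qed
  ultimately show ?thesis
    unfolding trig_moment_def by (simp only: integral_unique)
qed

section \<open>Functions of the form P(S) / S^3 without linear term in P\<close>

text \<open>The denominator S^3 is the one of the lowest moment and stays fixed. The vanishing
  linear coefficient is the invariant that later sharpens the root count. The range of r contains 0,
  where S = a; evaluating there yields the root a.\<close>

definition leg_representable :: "real \<Rightarrow> nat \<Rightarrow> (real \<Rightarrow> real) \<Rightarrow> bool" where
  "leg_representable a d F \<longleftrightarrow> (\<exists>P. degree P \<le> d \<and> coeff P 1 = 0 \<and>
     (\<forall>r. \<bar>r\<bar> < \<bar>a\<bar> \<longrightarrow> F r = poly P (signed_leg a r) / signed_leg a r ^ 3))"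

lemma leg_representableI:
  assumes "degree P \<le> d" "coeff P 1 = 0"
    and "\<And>r. \<bar>r\<bar> < \<bar>a\<bar> \<Longrightarrow> F r = poly P (signed_leg a r) / signed_leg a r ^ 3"
  shows "leg_representable a d F"
  unfolding leg_representable_def using assms by blast

lemma leg_representable_cong:
  assumes "leg_representable a d G" "\<And>r. \<bar>r\<bar> < \<bar>a\<bar> \<Longrightarrow> F r = G r"
  shows "leg_representable a d F"
  using assms unfolding leg_representable_def by metis

lemma leg_representable_mono:
  "leg_representable a d F \<Longrightarrow> d \<le> e \<Longrightarrow> leg_representable a e F"
  unfolding leg_representable_def by (meson le_trans)

lemma leg_representable_0: "leg_representable a d (\<lambda>r. 0)"
  by (rule leg_representableI[of 0]) auto

lemma leg_representable_add:
  assumes "leg_representable a d F" "leg_representable a d G"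
  shows "leg_representable a d (\<lambda>r. F r + G r)"
proof -
  obtain P where P: "degree P \<le> d" "coeff P 1 = 0"
      "\<And>r. \<bar>r\<bar> < \<bar>a\<bar> \<Longrightarrow> F r = poly P (signed_leg a r) / signed_leg a r ^ 3"
    using assms(1) unfolding leg_representable_def by blast
  obtain Q where Q: "degree Q \<le> d" "coeff Q 1 = 0"
      "\<And>r. \<bar>r\<bar> < \<bar>a\<bar> \<Longrightarrow> G r = poly Q (signed_leg a r) / signed_leg a r ^ 3"
    using assms(2) unfolding leg_representable_def by blast
  show ?thesis
    by (rule leg_representableI[of "P + Q"]) (use P Q in \<open>auto simp: degree_add_le add_divide_distrib\<close>)
qed

lemma leg_representable_cmult:
  assumes "leg_representable a d F"
  shows "leg_representable a d (\<lambda>r. c * F r)"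
proof -
  obtain P where P: "degree P \<le> d" "coeff P 1 = 0"
      "\<And>r. \<bar>r\<bar> < \<bar>a\<bar> \<Longrightarrow> F r = poly P (signed_leg a r) / signed_leg a r ^ 3"
    using assms(1) unfolding leg_representable_def by blast
  show ?thesis
    by (rule leg_representableI[of "smult c P"]) (use P in auto)
qed

lemma leg_representable_diff:
  assumes "leg_representable a d F" "leg_representable a d G"
  shows "leg_representable a d (\<lambda>r. F r - G r)"
  using leg_representable_add[OF assms(1) leg_representable_cmult[OF assms(2), of "- 1"]] by simp

lemma leg_representable_sum:
  assumes "\<And>i. i \<in> I \<Longrightarrow> leg_representable a d (F i)"
  shows "leg_representable a d (\<lambda>r. \<Sum>i\<in>I. F i r)"
  using assms by (induction I rule: infinite_finite_induct)
    (auto intro: leg_representable_0 leg_representable_add)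

lemma coeff_1_mult:
  fixes p q :: "'a::comm_semiring_0 poly"
  shows "coeff (p * q) 1 = coeff p 0 * coeff q 1 + coeff p 1 * coeff q 0"
  by (simp add: coeff_mult)

text \<open>Since r^2 = a^2 - S^2, the numerator is multiplied by a^2 - X^2, which also lacks a
  linear term, and a product of two such polynomials lacks it too.\<close>

lemma leg_representable_mult_radius_sq:
  assumes "leg_representable a d F"
  shows "leg_representable a (d + 2) (\<lambda>r. r\<^sup>2 * F r)"
proof -
  obtain P where P: "degree P \<le> d" "coeff P 1 = 0"
      "\<And>r. \<bar>r\<bar> < \<bar>a\<bar> \<Longrightarrow> F r = poly P (signed_leg a r) / signed_leg a r ^ 3"
    using assms unfolding leg_representable_def by blast
  define Q where "Q = [:a\<^sup>2, 0, - 1:] * P"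
  show ?thesis
  proof (rule leg_representableI[of Q])
    have "degree Q \<le> degree [:a\<^sup>2, 0, - 1:] + degree P"
      unfolding Q_def by (rule degree_mult_le)
    then show "degree Q \<le> d + 2"
      using P(1) by simp
    show "coeff Q 1 = 0"
      unfolding Q_def coeff_1_mult using P(2) by simp
    fix r :: real
    assume r: "\<bar>r\<bar> < \<bar>a\<bar>"
    have "poly [:a\<^sup>2, 0, - 1:] (signed_leg a r) = r\<^sup>2"
      using signed_leg_sq[OF r] by (simp add: power2_eq_square)
    then show "r\<^sup>2 * F r = poly Q (signed_leg a r) / signed_leg a r ^ 3"
      by (simp only: Q_def poly_mult P(3)[OF r] times_divide_eq_right)
  qed
qed

text \<open>Start from 1 = S^3 / S^3 and multiply by r^2 repeatedly.\<close>

lemma leg_representable_power: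
  assumes "even p"
  shows "leg_representable a (p + 3) (\<lambda>r. r ^ p)"
proof -
  have "leg_representable a (2 * k + 3) (\<lambda>r. r ^ (2 * k))" for k
  proof (induction k)
    case 0
    show ?case
      by (rule leg_representableI[of "[:0, 0, 0, 1:]"])
        (auto dest: signed_leg_nonzero simp: power3_eq_cube)
  next
    case (Suc k)
    from leg_representable_mult_radius_sq[OF this] show ?case
      by (simp add: power2_eq_square mult_ac add_ac)
  qed
  then show ?thesis
    using assms by (auto elim!: evenE)
qed

text \<open>Induction along \<open>trig_moment_cos_rec\<close>. The term with r^p is covered for
  even p by \<open>leg_representable_power\<close>; for odd p its coefficient, an integral of an odd
  cosine power, is 0.\<close>

lemma leg_representable_trig_moment_cos:
  "leg_representable a (p + 1) (trig_moment a p 0)"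
proof (induction p rule: induct_nat_012)
  case 0
  show ?case
    by (rule leg_representableI[of "[:2 * pi * a:]"]) (auto simp: trig_moment_0_0)
next
  case 1
  show ?case
    by (rule leg_representableI[of "[:- 2 * pi * a\<^sup>2, 0, 2 * pi:]"])
      (auto simp: trig_moment_1_0[unfolded One_nat_def] power2_eq_square algebra_simps)
next
  case (ge2 p)
  have "leg_representable a (p + 3) (\<lambda>r. integral {0..2 * pi} (\<lambda>\<theta>. cos \<theta> ^ p) * r ^ p)"
  proof (cases "even p")
    case True
    then show ?thesis
      by (intro leg_representable_cmult leg_representable_power)
  next
    case False
    then show ?thesis
      by (simp add: integral_cos_power_odd leg_representable_0)
  qed
  moreover have "leg_representable a (p + 3) (\<lambda>r. (2 * a) * trig_moment a (p + 1) 0 r)"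
    using ge2(2) by (intro leg_representable_cmult) (auto intro: leg_representable_mono)
  moreover have "leg_representable a (p + 3) (\<lambda>r. a\<^sup>2 * trig_moment a p 0 r)"
    using ge2(1) by (intro leg_representable_cmult) (auto intro: leg_representable_mono)
  ultimately have "leg_representable a (p + 3) (\<lambda>r. integral {0..2 * pi} (\<lambda>\<theta>. cos \<theta> ^ p) * r ^ p
      - (2 * a) * trig_moment a (p + 1) 0 r - a\<^sup>2 * trig_moment a p 0 r)"
    by (intro leg_representable_diff)
  then have "leg_representable a (p + 3) (trig_moment a (p + 2) 0)"
    by (rule leg_representable_cong) (simp add: trig_moment_cos_rec del: add_2_eq_Suc')
  then show ?case
    by (simp add: eval_nat_numeral)
qed

lemma leg_representable_trig_moment:
  "leg_representable a (p + q + 1) (trig_moment a p q)"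
proof (induction q arbitrary: p rule: induct_nat_012)
  case 0
  show ?case
    using leg_representable_trig_moment_cos by simp
next
  case 1
  have "trig_moment a p (Suc 0) = (\<lambda>r. 0)"
    by (simp add: fun_eq_iff trig_moment_odd_sin)
  then show ?case
    by (simp add: leg_representable_0)
next
  case (ge2 q)
  have "leg_representable a (p + q + 3) (\<lambda>r. r\<^sup>2 * trig_moment a p q r - trig_moment a (p + 2) q r)"
    using leg_representable_mult_radius_sq[OF ge2(1), of p] ge2(1)[of "p + 2"]
    by (intro leg_representable_diff) (simp_all add: eval_nat_numeral)
  then have "leg_representable a (p + q + 3) (trig_moment a p (q + 2))"
    by (rule leg_representable_cong) (simp add: trig_moment_sin_rec del: add_2_eq_Suc')
  then show ?case
    by (simp add: eval_nat_numeral)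
qed

text \<open>Multiplication by r turns the factors cos \<theta> and sin \<theta> into one more x or
  y. Monomials of degree at most n thus become moments of degree at most n + 1, whose numerators
  have degree at most n + 2.\<close>

lemma leg_representable_averaged_fun:
  assumes "f \<in> poly2_le n" "g \<in> poly2_le n"
  shows "leg_representable a (n + 2) (\<lambda>r. r * averaged_fun a f g r)"
proof -
  obtain c where f: "f = (\<lambda>x y. \<Sum>i\<le>n. \<Sum>j\<le>n - i. c i j * x ^ i * y ^ j)"
    using assms(1) by (auto simp: poly2_le_def)
  obtain d where g: "g = (\<lambda>x y. \<Sum>i\<le>n. \<Sum>j\<le>n - i. d i j * x ^ i * y ^ j)"
    using assms(2) by (auto simp: poly2_le_def)
  have "leg_representable a (n + 2) (\<lambda>r. \<Sum>i\<le>n. \<Sum>j\<le>n - i.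
      c i j * trig_moment a (i + 1) j r + d i j * trig_moment a i (j + 1) r)"
    by (intro leg_representable_sum leg_representable_add leg_representable_cmult
        leg_representable_mono[OF leg_representable_trig_moment]) auto
  then show ?thesis
  proof (rule leg_representable_cong)
    fix r assume r: "\<bar>r\<bar> < \<bar>a\<bar>"
    define m where "m p q \<theta> = (r * cos \<theta>) ^ p * (r * sin \<theta>) ^ q / (r * cos \<theta> + a)\<^sup>2" for p q \<theta>
    have "((\<lambda>\<theta>. \<Sum>i\<le>n. \<Sum>j\<le>n - i. c i j * m (i + 1) j \<theta> + d i j * m i (j + 1) \<theta>) has_integral
        (\<Sum>i\<le>n. \<Sum>j\<le>n - i. c i j * trig_moment a (i + 1) j r + d i j * trig_moment a i (j + 1) r)) {0..2 * pi}"
      unfolding m_def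
      by (intro has_integral_sum has_integral_add has_integral_mult_right trig_moment_has_integral r) auto
    moreover have "(\<Sum>i\<le>n. \<Sum>j\<le>n - i. c i j * m (i + 1) j \<theta> + d i j * m i (j + 1) \<theta>)
        = r * ((f (r * cos \<theta>) (r * sin \<theta>) * cos \<theta> + g (r * cos \<theta>) (r * sin \<theta>) * sin \<theta>)
           / (r * cos \<theta> + a)\<^sup>2)" for \<theta>
      unfolding f g m_def
      by (simp add: sum_distrib_left sum_distrib_right sum_divide_distrib sum.distrib
          add_divide_distrib distrib_left mult_ac)
    ultimately show "r * averaged_fun a f g r = (\<Sum>i\<le>n. \<Sum>j\<le>n - i.
        c i j * trig_moment a (i + 1) j r + d i j * trig_moment a i (j + 1) r)"
      unfolding averaged_fun_def integral_mult_right[symmetric] by (simp only: integral_unique)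
  qed
qed

section \<open>Closure properties of bivariate polynomials and linearity of averaging\<close>

lemma poly2_leI:
  assumes "\<And>x y. f x y = (\<Sum>i\<le>n. \<Sum>j\<le>n - i. c i j * x ^ i * y ^ j)"
  shows "f \<in> poly2_le n"
  unfolding poly2_le_def by (intro CollectI exI[of _ c] ext assms)

lemma poly2_le_monomial:
  assumes "i + j \<le> n"
  shows "(\<lambda>x y. c * x ^ i * y ^ j) \<in> poly2_le n"
proof -
  define d where "d i' j' = (if i' = i \<and> j' = j then c else 0)" for i' j'
  have "(\<Sum>j'\<le>n - i'. d i' j' * x ^ i' * y ^ j') = (if i' = i then c * x ^ i * y ^ j else 0)" for i' x y
  proof -
    have "d i' j' * x ^ i' * y ^ j' = (if j' = j then if i' = i then c * x ^ i * y ^ j else 0 else 0)" for j'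
      by (simp add: d_def)
    then show ?thesis
      using assms by (simp add: le_diff_conv2)
  qed
  then have "(\<Sum>i'\<le>n. \<Sum>j'\<le>n - i'. d i' j' * x ^ i' * y ^ j') = c * x ^ i * y ^ j" for x y
    using assms by simp
  then show ?thesis
    by (intro poly2_leI[where c = d]) simp
qed

lemma poly2_le_add:
  assumes "f \<in> poly2_le n" "g \<in> poly2_le n"
  shows "(\<lambda>x y. f x y + g x y) \<in> poly2_le n"
proof -
  obtain c where f: "f = (\<lambda>x y. \<Sum>i\<le>n. \<Sum>j\<le>n - i. c i j * x ^ i * y ^ j)"
    using assms(1) by (auto simp: poly2_le_def)
  obtain d where g: "g = (\<lambda>x y. \<Sum>i\<le>n. \<Sum>j\<le>n - i. d i j * x ^ i * y ^ j)"
    using assms(2) by (auto simp: poly2_le_def)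
  show ?thesis
    by (rule poly2_leI[where c = "\<lambda>i j. c i j + d i j"]) (simp add: f g distrib_right sum.distrib)
qed

lemma poly2_le_zero: "(\<lambda>x y. 0) \<in> poly2_le n"
  using poly2_le_monomial[of 0 0 n 0] by simp

lemma poly2_le_sum:
  assumes "\<And>i. i \<in> I \<Longrightarrow> F i \<in> poly2_le n"
  shows "(\<lambda>x y. \<Sum>i\<in>I. F i x y) \<in> poly2_le n"
  using assms by (induction I rule: infinite_finite_induct) (auto intro: poly2_le_zero poly2_le_add)

text \<open>A single statement serves for scaling, for raising the degree bound and for the later
  products with x^2 and y^2.\<close>

lemma poly2_le_mult_monomial:
  assumes "f \<in> poly2_le n" "n + p + q \<le> m"
  shows "(\<lambda>x y. c * x ^ p * y ^ q * f x y) \<in> poly2_le m"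
proof -
  obtain d where f: "f = (\<lambda>x y. \<Sum>i\<le>n. \<Sum>j\<le>n - i. d i j * x ^ i * y ^ j)"
    using assms(1) by (auto simp: poly2_le_def)
  have "(\<lambda>x y. \<Sum>i\<le>n. \<Sum>j\<le>n - i. (c * d i j) * x ^ (i + p) * y ^ (j + q)) \<in> poly2_le m"
    using assms(2) by (intro poly2_le_sum poly2_le_monomial) auto
  then show ?thesis
    by (simp add: f sum_distrib_left power_add mult_ac)
qed

lemma poly2_le_mono:
  assumes "f \<in> poly2_le n" "n \<le> m"
  shows "f \<in> poly2_le m"
  using poly2_le_mult_monomial[OF assms(1), of 0 0 m 1] assms(2) by simp

lemma poly2_le_cmult: "f \<in> poly2_le n \<Longrightarrow> (\<lambda>x y. c * f x y) \<in> poly2_le n"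
  using poly2_le_mult_monomial[of f n 0 0 n c] by simp

lemma averaged_integrand_integrable:
  assumes "f \<in> poly2_le n" "\<bar>r\<bar> < \<bar>a\<bar>"
  shows "(\<lambda>\<theta>. f (r * cos \<theta>) (r * sin \<theta>) * cos \<theta> / (r * cos \<theta> + a)\<^sup>2) integrable_on {0..2 * pi}"
proof -
  obtain c where f: "f = (\<lambda>x y. \<Sum>i\<le>n. \<Sum>j\<le>n - i. c i j * x ^ i * y ^ j)"
    using assms(1) by (auto simp: poly2_le_def)
  show ?thesis
    unfolding f by (intro integrable_over_denominator_sq assms continuous_intros)
qed

lemma averaged_fun_add_cmult:
  assumes "f \<in> poly2_le n" "h \<in> poly2_le m" "\<bar>r\<bar> < \<bar>a\<bar>"
  shows "averaged_fun a (\<lambda>x y. f x y + c * h x y) (\<lambda>x y. 0) r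
    = averaged_fun a f (\<lambda>x y. 0) r + c * averaged_fun a h (\<lambda>x y. 0) r"
proof -
  have "((\<lambda>\<theta>. f (r * cos \<theta>) (r * sin \<theta>) * cos \<theta> / (r * cos \<theta> + a)\<^sup>2
        + c * (h (r * cos \<theta>) (r * sin \<theta>) * cos \<theta> / (r * cos \<theta> + a)\<^sup>2)) has_integral
      (averaged_fun a f (\<lambda>x y. 0) r + c * averaged_fun a h (\<lambda>x y. 0) r)) {0..2 * pi}"
    using averaged_integrand_integrable[OF assms(1,3)] averaged_integrand_integrable[OF assms(2,3)]
    unfolding averaged_fun_def
    by (intro has_integral_add has_integral_mult_right) (auto simp: integrable_integral)
  moreover have "f (r * cos \<theta>) (r * sin \<theta>) * cos \<theta> / (r * cos \<theta> + a)\<^sup>2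
        + c * (h (r * cos \<theta>) (r * sin \<theta>) * cos \<theta> / (r * cos \<theta> + a)\<^sup>2)
      = ((f (r * cos \<theta>) (r * sin \<theta>) + c * h (r * cos \<theta>) (r * sin \<theta>)) * cos \<theta> + 0 * sin \<theta>)
        / (r * cos \<theta> + a)\<^sup>2" for \<theta>
    by (simp add: add_divide_distrib distrib_right)
  ultimately show ?thesis
    unfolding averaged_fun_def by (simp only: integral_unique)
qed

text \<open>The first integral x^2 + y^2 is constant on each circle of integration.\<close>

lemma averaged_fun_mult_radius_sq:
  "averaged_fun a (\<lambda>x y. (x\<^sup>2 + y\<^sup>2) * f x y) (\<lambda>x y. 0) r = r\<^sup>2 * averaged_fun a f (\<lambda>x y. 0) r"
proof -
  have "(r * cos \<theta>)\<^sup>2 + (r * sin \<theta>)\<^sup>2 = r\<^sup>2" for \<theta>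
    using sin_cos_squared_add2[of \<theta>] by algebra
  then show ?thesis
    unfolding averaged_fun_def integral_mult_right[symmetric] by (simp add: mult_ac)
qed

section \<open>Realizing every admissible numerator by a perturbation\<close>

text \<open>The perturbations 1 and x start the two parity classes. Each factor x^2 + y^2 multiplies
  the numerator by a^2 - X^2, raising its degree by exactly 2 and keeping the other conditions. The
  results serve as a basis graded by degree.\<close>

lemma exists_realization_of_exact_degree:
  assumes "a \<noteq> 0"
  shows "\<exists>h \<in> poly2_le n. \<exists>E. degree E = n + 2 \<and> coeff E 1 = 0 \<and> poly E a = 0 \<and>
    (\<forall>r. \<bar>r\<bar> < \<bar>a\<bar> \<longrightarrow>
       r * averaged_fun a h (\<lambda>x y. 0) r = poly E (signed_leg a r) / signed_leg a r ^ 3)"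
proof (induction n rule: induct_nat_012)
  case 0
  \<comment> \<open>The perturbation 1 produces the moment of x; this is its numerator, 2 pi (X^2 -
    a^2).\<close>
  define E where "E = [:- 2 * pi * a\<^sup>2, 0, 2 * pi:]"
  have "r * averaged_fun a (\<lambda>x y. 1) (\<lambda>x y. 0) r = trig_moment a 1 0 r" for r
    unfolding averaged_fun_def trig_moment_def integral_mult_right[symmetric] by simp
  then have "r * averaged_fun a (\<lambda>x y. 1) (\<lambda>x y. 0) r = poly E (signed_leg a r) / signed_leg a r ^ 3"
    if "\<bar>r\<bar> < \<bar>a\<bar>" for r
    using trig_moment_1_0[OF that] by (simp add: E_def power2_eq_square algebra_simps)
  moreover have "degree E = 0 + 2" "coeff E 1 = 0" "poly E a = 0"
    by (simp_all add: E_def power2_eq_square)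
  moreover have "(\<lambda>x y. 1) \<in> poly2_le 0"
    using poly2_le_monomial[of 0 0 0 1] by simp
  ultimately show ?case
    by blast
next
  case 1
  \<comment> \<open>The perturbation x produces the moment of x^2;
    \<open>trig_moment_cos_rec\<close> gives the numerator 2 pi (X^3 - 2 a X^2 + a^3).\<close>
  define E where "E = [:2 * pi * a ^ 3, 0, - 4 * pi * a, 2 * pi:]"
  have "r * averaged_fun a (\<lambda>x y. x) (\<lambda>x y. 0) r = trig_moment a (0 + 2) 0 r" for r
    unfolding averaged_fun_def trig_moment_def integral_mult_right[symmetric]
    by (simp add: power2_eq_square mult_ac)
  moreover have "trig_moment a (0 + 2) 0 r = poly E (signed_leg a r) / signed_leg a r ^ 3"
    if r: "\<bar>r\<bar> < \<bar>a\<bar>" for r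
  proof -
    define S where "S = signed_leg a r"
    have "S \<noteq> 0"
      using signed_leg_nonzero[OF r] by (simp add: S_def)
    have "trig_moment a (0 + 2) 0 r
        = 2 * pi - 2 * a * (2 * pi * (S\<^sup>2 - a\<^sup>2) / S ^ 3) - a\<^sup>2 * (2 * pi * a / S ^ 3)"
      unfolding trig_moment_cos_rec[OF r] using trig_moment_0_0[OF r] trig_moment_1_0[OF r]
      by (simp add: S_def)
    also have "\<dots> = poly E S / S ^ 3"
      using \<open>S \<noteq> 0\<close> by (simp add: E_def field_simps power2_eq_square power3_eq_cube)
    finally show ?thesis
      by (simp only: S_def)
  qed
  moreover have "degree E = 1 + 2" "coeff E 1 = 0" "poly E a = 0"
    by (simp_all add: E_def power3_eq_cube algebra_simps)
  moreover have "(\<lambda>x y. x) \<in> poly2_le 1"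
    using poly2_le_monomial[of 1 0 1 1] by simp
  ultimately show ?case
    unfolding One_nat_def[symmetric] by metis
next
  case (ge2 n)
  then obtain h E where h: "h \<in> poly2_le n" and E: "degree E = n + 2" "coeff E 1 = 0" "poly E a = 0"
    and hE: "\<And>r. \<bar>r\<bar> < \<bar>a\<bar> \<Longrightarrow>
       r * averaged_fun a h (\<lambda>x y. 0) r = poly E (signed_leg a r) / signed_leg a r ^ 3"
    by blast
  define E' where "E' = [:a\<^sup>2, 0, - 1:] * E"
  have "degree E' = n + 2 + 2"
    using E(1) unfolding E'_def by (subst degree_mult_eq) auto
  moreover have "coeff E' 1 = 0"
    unfolding E'_def coeff_1_mult using E(2) by simp
  moreover have "poly E' a = 0"
    by (simp only: E'_def poly_mult E(3) mult_zero_right)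
  moreover have "(\<lambda>x y. (x\<^sup>2 + y\<^sup>2) * h x y) \<in> poly2_le (n + 2)"
    using poly2_le_add[OF poly2_le_mult_monomial[OF h, of 2 0 "n + 2" 1]
        poly2_le_mult_monomial[OF h, of 0 2 "n + 2" 1]]
    by (simp add: distrib_right)
  moreover have "r * averaged_fun a (\<lambda>x y. (x\<^sup>2 + y\<^sup>2) * h x y) (\<lambda>x y. 0) r
      = poly E' (signed_leg a r) / signed_leg a r ^ 3" if r: "\<bar>r\<bar> < \<bar>a\<bar>" for r
  proof -
    have "poly [:a\<^sup>2, 0, - 1:] (signed_leg a r) = r\<^sup>2"
      using signed_leg_sq[OF r] by (simp add: power2_eq_square)
    moreover have "r * averaged_fun a (\<lambda>x y. (x\<^sup>2 + y\<^sup>2) * h x y) (\<lambda>x y. 0) r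
        = r\<^sup>2 * (r * averaged_fun a h (\<lambda>x y. 0) r)"
      unfolding averaged_fun_mult_radius_sq by simp
    ultimately show ?thesis
      by (simp only: E'_def poly_mult hE[OF r] times_divide_eq_right)
  qed
  ultimately show ?case
    unfolding add_2_eq_Suc' by blast
qed

lemma degree_le_of_coeff_eq_0:
  assumes "degree p \<le> Suc n" "coeff p (Suc n) = 0"
  shows "degree p \<le> n"
proof (intro degree_le allI impI)
  fix i assume "n < i"
  with assms show "coeff p i = 0"
    by (cases "i = Suc n") (auto intro: coeff_eq_0)
qed

text \<open>Elimination from the top: a multiple of the realized polynomial of degree n + 2 removes
  the leading term, and the difference is again admissible of smaller degree.\<close>

lemma exists_realization:
  assumes "a \<noteq> 0" "degree P \<le> n + 1" "coeff P 1 = 0" "poly P a = 0"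
  shows "\<exists>f \<in> poly2_le (n - 1). \<forall>r. \<bar>r\<bar> < \<bar>a\<bar> \<longrightarrow>
    r * averaged_fun a f (\<lambda>x y. 0) r = poly P (signed_leg a r) / signed_leg a r ^ 3"
  using assms(2-)
proof (induction n arbitrary: P)
  case 0
  then have "degree P \<le> 0"
    using degree_le_of_coeff_eq_0[of P 0] by simp
  then obtain c where "P = [:c:]"
    by (auto dest: degree0_coeffs)
  with 0(3) have "P = 0"
    by simp
  then have "\<forall>r. \<bar>r\<bar> < \<bar>a\<bar> \<longrightarrow>
      r * averaged_fun a (\<lambda>x y. 0) (\<lambda>x y. 0) r = poly P (signed_leg a r) / signed_leg a r ^ 3"
    by (simp add: averaged_fun_def)
  then show ?case
    by (rule bexI[OF _ poly2_le_zero])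
next
  case (Suc n)
  obtain h E where h: "h \<in> poly2_le n" and E: "degree E = n + 2" "coeff E 1 = 0" "poly E a = 0"
    and hE: "\<And>r. \<bar>r\<bar> < \<bar>a\<bar> \<Longrightarrow>
       r * averaged_fun a h (\<lambda>x y. 0) r = poly E (signed_leg a r) / signed_leg a r ^ 3"
    using exists_realization_of_exact_degree[OF assms(1), of n] by blast
  define c where "c = coeff P (n + 2) / coeff E (n + 2)"
  define Q where "Q = P - smult c E"
  have "lead_coeff E \<noteq> 0"
    using E(1) by (intro leading_coeff_neq_0) auto
  then have "coeff Q (n + 2) = 0"
    by (simp add: Q_def c_def E(1))
  moreover have "degree Q \<le> n + 2"
    unfolding Q_def using Suc.prems(1) E(1) by (intro degree_diff_le) auto
  ultimately have "degree Q \<le> n + 1"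
    using degree_le_of_coeff_eq_0[of Q "n + 1"] by simp
  then obtain f where f: "f \<in> poly2_le (n - 1)"
    and fQ: "\<And>r. \<bar>r\<bar> < \<bar>a\<bar> \<Longrightarrow>
       r * averaged_fun a f (\<lambda>x y. 0) r = poly Q (signed_leg a r) / signed_leg a r ^ 3"
    using Suc.IH[of Q] Suc.prems(2,3) E(2,3) by (auto simp: Q_def)
  have "(\<lambda>x y. f x y + c * h x y) \<in> poly2_le n"
    using f h by (intro poly2_le_add poly2_le_cmult) (auto intro: poly2_le_mono)
  moreover have "r * averaged_fun a (\<lambda>x y. f x y + c * h x y) (\<lambda>x y. 0) r
      = poly P (signed_leg a r) / signed_leg a r ^ 3" if r: "\<bar>r\<bar> < \<bar>a\<bar>" for r
  proof -
    have "r * averaged_fun a (\<lambda>x y. f x y + c * h x y) (\<lambda>x y. 0) r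
        = r * averaged_fun a f (\<lambda>x y. 0) r + c * (r * averaged_fun a h (\<lambda>x y. 0) r)"
      unfolding averaged_fun_add_cmult[OF f h r] by (simp add: algebra_simps)
    also have "\<dots> = poly P (signed_leg a r) / signed_leg a r ^ 3"
      unfolding fQ[OF r] hE[OF r] by (simp add: Q_def diff_divide_distrib)
    finally show ?thesis .
  qed
  ultimately show ?case
    by auto
qed

section \<open>Roots of polynomials without linear term\<close>

text \<open>This is the logarithmic derivative at 0: Q'(0) = Q(0) times the sum of 1 / (0 - z), with
  Q(0) the product of the - z.\<close>

lemma coeff_1_prod_linear:
  fixes Z :: "'a::field set"
  assumes "finite Z" "0 \<notin> Z"
  shows "coeff (\<Prod>z\<in>Z. [:- z, 1:]) 1 = - (\<Prod>z\<in>Z. - z) * (\<Sum>z\<in>Z. 1 / z)"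
  using assms
proof (induction Z rule: finite_induct)
  case (insert z Z)
  have "coeff (\<Prod>z\<in>Z. [:- z, 1:]) 0 = (\<Prod>z\<in>Z. - z)"
    by (simp add: poly_0_coeff_0[symmetric] poly_prod)
  moreover have "coeff [:- z, 1:] 1 = 1"
    by simp
  moreover have "coeff (\<Prod>z\<in>insert z Z. [:- z, 1:]) 1
      = coeff [:- z, 1:] 0 * coeff (\<Prod>z\<in>Z. [:- z, 1:]) 1 + coeff [:- z, 1:] 1 * coeff (\<Prod>z\<in>Z. [:- z, 1:]) 0"
    unfolding prod.insert[OF insert.hyps] coeff_1_mult ..
  ultimately show ?case
    using insert by (simp add: field_simps)
qed simp

lemma card_same_sign_roots_le:
  fixes P :: "real poly"
  assumes "a \<noteq> 0" "P \<noteq> 0" "degree P \<le> d + 1" "coeff P 1 = 0"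
  shows "card {z. poly P z = 0 \<and> z * a > 0} \<le> d"
proof (rule ccontr)
  assume "\<not> ?thesis"
  then have "d + 1 \<le> card {z. poly P z = 0 \<and> z * a > 0}"
    by simp
  then obtain Z where Z: "Z \<subseteq> {z. poly P z = 0 \<and> z * a > 0}" "card Z = d + 1"
    by (rule obtain_subset_with_card_n)
  have fin: "finite Z"
    using Z(2) by (simp add: card_ge_0_finite)
  have nz: "0 \<notin> Z"
    using Z(1) by auto
  define Q where "Q = (\<Prod>z\<in>Z. [:- z, 1:])"
  have degQ: "degree Q = d + 1"
    using Z(2) by (simp add: Q_def degree_prod_sum_eq)
  have "lead_coeff Q = 1"
    by (simp add: Q_def lead_coeff_prod)
  \<comment> \<open>Both sides have degree at most d + 1, the same coefficient there, and agree at
    the d + 1 points of \<open>Z\<close>. The coefficient could be 0 a priori; P \<noteq> 0 excludes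
    this afterwards.\<close>
  then have PQ: "P = smult (coeff P (d + 1)) Q"
  proof (intro poly_eqI_degree_lead_coeff[of P "d + 1" _ Z])
    show "poly P z = poly (smult (coeff P (d + 1)) Q) z" if "z \<in> Z" for z
      using that Z(1) fin by (auto simp: Q_def poly_prod prod_zero_iff)
  qed (use Z(2) assms(3) degQ in auto)
  have "coeff P (d + 1) \<noteq> 0"
    using PQ assms(2) by auto
  then have "coeff Q 1 = 0"
    using PQ assms(4) by (metis coeff_smult mult_eq_0_iff)
  then have "(\<Sum>z\<in>Z. 1 / z) = 0"
    using fin nz unfolding Q_def coeff_1_prod_linear[OF fin nz] by auto
  \<comment> \<open>Multiplying by a makes every summand positive whichever sign a has.\<close>
  then have "a * (\<Sum>z\<in>Z. 1 / z) = 0"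
    by simp
  then have "(\<Sum>z\<in>Z. a / z) = 0"
    by (simp only: sum_distrib_left times_divide_eq_right mult_1_right)
  moreover have "(\<Sum>z\<in>Z. a / z) > 0"
    using Z fin by (intro sum_pos) (auto simp: zero_less_mult_iff zero_less_divide_iff)
  ultimately show False
    by simp
qed

text \<open>Splitting off the factor of z, the derivative at z equals the product of the z - w over
  the other points, all nonzero.\<close>

lemma poly_pderiv_prod_linear_root:
  fixes Z :: "'a::field set"
  assumes "finite Z" "z \<in> Z"
  shows "poly (pderiv (\<Prod>w\<in>Z. [:- w, 1:])) z \<noteq> 0"
proof -
  have "(\<Prod>w\<in>Z. [:- w, 1:]) = [:- z, 1:] * (\<Prod>w\<in>Z - {z}. [:- w, 1:])"
    using assms by (simp add: prod.remove)
  then have "poly (pderiv (\<Prod>w\<in>Z. [:- w, 1:])) z = poly (\<Prod>w\<in>Z - {z}. [:- w, 1:]) z"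
    by (simp only: pderiv_mult) (simp add: pderiv_pCons)
  then show ?thesis
    using assms(1) by (auto simp: poly_prod)
qed

section \<open>Transfer between roots in S and zeros in r\<close>

lemma signed_leg_has_derivative:
  assumes "\<bar>r\<bar> < \<bar>a\<bar>"
  shows "(signed_leg a has_real_derivative - r / signed_leg a r) (at r)"
proof -
  have "((\<lambda>r. sgn a * sqrt (a\<^sup>2 - r\<^sup>2)) has_real_derivative
      sgn a * (- (2 * r) * (inverse (sqrt (a\<^sup>2 - r\<^sup>2)) / 2))) (at r)"
    using sq_diff_pos[OF assms] by (auto intro!: derivative_eq_intros)
  then show ?thesis
    unfolding signed_leg_def by (simp add: sgn_if field_simps split: if_splits)
qed

text \<open>By the chain rule the derivative is P'(S) times dS/dr = - r / S, divided by r S^3; the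
  factor - r / S is nonzero because r > 0.\<close>

lemma simple_zero_at_simple_root:
  assumes F: "\<And>r. \<bar>r\<bar> < \<bar>a\<bar> \<Longrightarrow> r * F r = poly P (signed_leg a r) / signed_leg a r ^ 3"
    and r: "0 < r" "r < \<bar>a\<bar>"
    and P: "poly P (signed_leg a r) = 0" "poly (pderiv P) (signed_leg a r) \<noteq> 0"
  shows "simple_zero F r"
proof -
  define S where "S = signed_leg a r"
  have ra: "\<bar>r\<bar> < \<bar>a\<bar>"
    using r by simp
  have S: "S \<noteq> 0"
    using signed_leg_nonzero[OF ra] by (simp add: S_def)
  have dS: "(signed_leg a has_real_derivative - r / S) (at r)"
    using signed_leg_has_derivative[OF ra] by (simp add: S_def)
  define G where "G r = poly P (signed_leg a r) / (r * signed_leg a r ^ 3)" for r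
  have num: "((\<lambda>r. poly P (signed_leg a r)) has_real_derivative poly (pderiv P) S * (- r / S)) (at r)"
    using DERIV_chain2[OF poly_DERIV dS[unfolded S_def]] by (simp add: S_def)
  have den: "((\<lambda>r. r * signed_leg a r ^ 3) has_real_derivative
      S ^ 3 + r * (3 * S\<^sup>2 * (- r / S))) (at r)"
    using S unfolding S_def
    by (auto intro!: derivative_eq_intros dS[unfolded S_def] simp: field_simps)
  have G: "(G has_real_derivative poly (pderiv P) S * (- r / S) / (r * S ^ 3)) (at r)"
    unfolding G_def
  proof (rule DERIV_cong[OF DERIV_divide[OF num den]])
    \<comment> \<open>Since P(S) = 0, the term of the quotient rule with the derivative of the
      denominator drops out.\<close>
    define w where "w = r * S ^ 3"
    have "w \<noteq> 0"
      using S r by (simp add: w_def)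
    then have "(x * w - 0 * y) / (w * w) = x / w" for x y
      by simp
    then show "(poly (pderiv P) S * (- r / S) * (r * signed_leg a r ^ 3)
        - poly P (signed_leg a r) * (S ^ 3 + r * (3 * S\<^sup>2 * (- r / S))))
        / (r * signed_leg a r ^ 3 * (r * signed_leg a r ^ 3)) = poly (pderiv P) S * (- r / S) / (r * S ^ 3)"
      unfolding S_def[symmetric] P(1)[folded S_def] w_def by (simp only:)
  qed (use S r in \<open>simp add: S_def\<close>)
  have "(F has_real_derivative poly (pderiv P) S * (- r / S) / (r * S ^ 3)) (at r)"
  proof (rule has_field_derivative_transform_within_open[OF G])
    fix t assume "t \<in> {0<..<\<bar>a\<bar>}"
    then have t: "\<bar>t\<bar> < \<bar>a\<bar>" "t \<noteq> 0"
      by auto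
    then have "F t = t * F t / t"
      by simp
    then show "G t = F t"
      using F[OF t(1)] by (simp add: G_def mult.commute)
  qed (use r in auto)
  moreover have "poly (pderiv P) S * (- r / S) / (r * S ^ 3) \<noteq> 0"
    using S r P(2) by (simp add: S_def)
  moreover have "F r = 0"
    using F[OF ra] P(1) r by simp
  ultimately show ?thesis
    unfolding simple_zero_def by blast
qed

text \<open>Handles the degenerate case in which the numerator P is the zero polynomial.\<close>

lemma not_simple_zero_of_vanishing:
  assumes "open A" "r \<in> A" "\<And>t. t \<in> A \<Longrightarrow> F t = 0"
  shows "\<not> simple_zero F r"
proof
  assume "simple_zero F r"
  then obtain D where D: "(F has_real_derivative D) (at r)" "D \<noteq> 0"
    by (auto simp: simple_zero_def)
  have "(F has_real_derivative 0) (at r)"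
    by (rule has_field_derivative_transform_within_open[OF DERIV_const assms(1,2)])
      (simp add: assms(3))
  with D show False
    using DERIV_unique by blast
qed

text \<open>S determines r^2 = a^2 - S^2, hence the positive r; so radii can be counted by their
  values of S.\<close>

lemma signed_leg_inj_on: "inj_on (signed_leg a) {0<..<\<bar>a\<bar>}"
proof (rule inj_onI)
  fix r t assume rt: "r \<in> {0<..<\<bar>a\<bar>}" "t \<in> {0<..<\<bar>a\<bar>}" and eq: "signed_leg a r = signed_leg a t"
  from rt have "\<bar>r\<bar> < \<bar>a\<bar>" "\<bar>t\<bar> < \<bar>a\<bar>"
    by auto
  from this[THEN signed_leg_sq] have "a\<^sup>2 - r\<^sup>2 = a\<^sup>2 - t\<^sup>2"
    unfolding eq by (rule trans[OF sym])
  then have "r\<^sup>2 = t\<^sup>2"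
    by simp
  then show "r = t"
    by (rule power2_eq_imp_eq) (use rt in auto)
qed

section \<open>The upper bound and its attainment\<close>

lemma averaging_limit_cycles_bound:
  assumes a: "a \<noteq> 0" and "f \<in> poly2_le n" "g \<in> poly2_le n"
  shows "finite (averaging_limit_cycles a f g) \<and> card (averaging_limit_cycles a f g) \<le> n"
proof -
  define L where "L = averaging_limit_cycles a f g"
  obtain P where P: "degree P \<le> n + 2" "coeff P 1 = 0"
    and F: "\<And>r. \<bar>r\<bar> < \<bar>a\<bar> \<Longrightarrow> r * averaged_fun a f g r = poly P (signed_leg a r) / signed_leg a r ^ 3"
    using leg_representable_averaged_fun[OF assms(2,3), of a] unfolding leg_representable_def by blast
  have L: "L \<subseteq> {0<..<\<bar>a\<bar>}"
    by (auto simp: L_def averaging_limit_cycles_def)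
  show ?thesis
  proof (cases "P = 0")
    case True
    have "\<not> simple_zero (averaged_fun a f g) r" if "r \<in> {0<..<\<bar>a\<bar>}" for r
    proof (rule not_simple_zero_of_vanishing[OF _ that])
      show "averaged_fun a f g t = 0" if "t \<in> {0<..<\<bar>a\<bar>}" for t
        using F[of t] that True by simp
    qed simp
    then have "L = {}"
      by (auto simp: L_def averaging_limit_cycles_def)
    then show ?thesis
      by (simp add: L_def)
  next
    case False
    define R where "R = {z. poly P z = 0 \<and> z * a > 0}"
    have finR: "finite R"
      unfolding R_def using poly_roots_finite[OF False] by (rule finite_subset[rotated]) auto
    have cardR: "card R \<le> n + 1"
      unfolding R_def using card_same_sign_roots_le[OF a False _ P(2), of "n + 1"] P(1) by simp
    \<comment> \<open>At r = 0 the left side of \<open>F\<close> vanishes and S = a, so P(a) = 0.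
      This root belongs to no radius in the annulus.\<close>
    have "a \<in> R"
      using F[of 0] a by (auto simp: R_def zero_less_mult_iff)
    have img: "signed_leg a ` L \<subseteq> R - {a}"
    proof
      fix z assume "z \<in> signed_leg a ` L"
      then obtain r where z: "z = signed_leg a r" and r: "0 < r" "\<bar>r\<bar> < \<bar>a\<bar>" "averaged_fun a f g r = 0"
        by (auto simp: L_def averaging_limit_cycles_def simple_zero_def)
      have "poly P z = 0"
        using F[OF r(2)] r(3) signed_leg_nonzero[OF r(2)] by (simp add: z)
      moreover have "z \<noteq> a"
        using signed_leg_sq[OF r(2)] r(1) by (auto simp: z)
      ultimately show "z \<in> R - {a}"
        using signed_leg_same_sign[OF r(2)] by (simp add: R_def z)
    qed
    have inj: "inj_on (signed_leg a) L"
      by (rule inj_on_subset[OF signed_leg_inj_on L])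
    have "finite L"
      using img finR inj by (meson finite_Diff finite_imageD finite_subset)
    moreover have "card L \<le> card (R - {a})"
      by (rule card_inj_on_le[OF inj img]) (simp add: finR)
    moreover have "card (R - {a}) \<le> n"
      using cardR \<open>a \<in> R\<close> finR by simp
    ultimately show ?thesis
      by (simp add: L_def)
  qed
qed

lemma exists_averaging_limit_cycles:
  assumes a: "a \<noteq> 0"
  shows "\<exists>f \<in> poly2_le n. n \<le> card (averaging_limit_cycles a f (\<lambda>x y. 0))"
proof -
  \<comment> \<open>Equally spaced roots between 0 and a; the first n will give the limit cycles,
    and \<rho> (n + 1) = a is the root forced by r = 0.\<close>
  define \<rho> where "\<rho> i = a * (i / (n + 1))" for i :: nat
  \<comment> \<open>The extra root - t has reciprocal - (1 / t), which cancels the reciprocals of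
    all other roots and so removes the linear coefficient. As t has the sign of a, - t lies on the
    other side of 0.\<close>
  define t where "t = 1 / (\<Sum>i=1..n + 1. 1 / \<rho> i)"
  define Z where "Z = insert (- t) (\<rho> ` {1..n + 1})"
  define P where "P = (\<Prod>z\<in>Z. [:- z, 1:])"
  have inj: "inj \<rho>"
    using a by (auto simp: inj_def \<rho>_def)
  have sign: "\<rho> i * a > 0" if "i \<ge> 1" for i
  proof -
    have "\<rho> i * a = a * a * (i / (n + 1))"
      by (simp add: \<rho>_def)
    moreover have "a * a > 0"
      using a not_real_square_gt_zero by blast
    ultimately show ?thesis
      using that by simp
  qed
  have "a / \<rho> i > 0" if "i \<ge> 1" for i
    using that a by (simp add: \<rho>_def)
  then have "(\<Sum>i=1..n + 1. a / \<rho> i) > 0"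
    by (intro sum_pos) auto
  then have "a * (\<Sum>i=1..n + 1. 1 / \<rho> i) > 0"
    by (simp only: sum_distrib_left times_divide_eq_right mult_1_right)
  then have t: "t * a > 0"
    unfolding t_def by (auto simp only: zero_less_mult_iff zero_less_divide_iff mult_1_left times_divide_eq_left)
  have tZ: "- t \<notin> \<rho> ` {1..n + 1}"
  proof
    assume "- t \<in> \<rho> ` {1..n + 1}"
    then obtain i where "- t = \<rho> i" "i \<ge> 1"
      by auto
    with sign[of i] have "- t * a > 0"
      by simp
    then show False
      using t by simp
  qed
  have "\<rho> i \<noteq> 0" if "i \<ge> 1" for i
    using sign[OF that] by auto
  moreover have "t \<noteq> 0"
    using t by auto
  ultimately have Z: "finite Z" "0 \<notin> Z"
    unfolding Z_def by force+
  have "card Z = n + 2"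
    using tZ by (simp add: Z_def card_image inj_on_subset[OF inj subset_UNIV])
  then have degP: "degree P = n + 2"
    by (simp add: P_def degree_prod_sum_eq)
  have "(\<Sum>z\<in>Z. 1 / z) = - (1 / t) + (\<Sum>i=1..n + 1. 1 / \<rho> i)"
    unfolding Z_def using tZ by (simp add: sum.reindex inj_on_subset[OF inj subset_UNIV])
  also have "\<dots> = 0"
    by (simp add: t_def)
  finally have "coeff P 1 = 0"
    unfolding P_def coeff_1_prod_linear[OF Z] by simp
  moreover have root: "poly P z = 0" if "z \<in> Z" for z
    using that Z(1) by (auto simp: P_def poly_prod)
  moreover have "\<rho> (n + 1) = a"
    by (simp add: \<rho>_def)
  then have "a \<in> Z"
    by (force simp: Z_def)
  ultimately obtain f where f: "f \<in> poly2_le n"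
    and F: "\<And>r. \<bar>r\<bar> < \<bar>a\<bar> \<Longrightarrow>
       r * averaged_fun a f (\<lambda>x y. 0) r = poly P (signed_leg a r) / signed_leg a r ^ 3"
    using exists_realization[OF a, of P "n + 1"] degP by auto
  define L where "L = averaging_limit_cycles a f (\<lambda>x y. 0)"
  have "\<rho> ` {1..n} \<subseteq> signed_leg a ` L"
  proof
    fix z assume "z \<in> \<rho> ` {1..n}"
    then obtain i where i: "1 \<le> i" "i \<le> n" and z: "z = \<rho> i"
      by auto
    define q where "q = real i / (real n + 1)"
    have q: "0 < q" "q < 1" "z = a * q"
      using i by (auto simp: q_def z \<rho>_def)
    \<comment> \<open>The positive solution of S = a q, from a^2 - r^2 = (a q)^2.\<close>
    define r where "r = \<bar>a\<bar> * sqrt (1 - q\<^sup>2)"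
    have q2: "0 < q\<^sup>2" "q\<^sup>2 < 1"
      using q by (auto simp: power_less_one_iff abs_square_less_1)
    then have r: "0 < r" "r < \<bar>a\<bar>"
      using a by (auto simp: r_def)
    have "a\<^sup>2 - r\<^sup>2 = (a * q)\<^sup>2"
      using q2 by (simp add: r_def power_mult_distrib algebra_simps)
    then have "signed_leg a r = sgn a * \<bar>a * q\<bar>"
      by (simp add: signed_leg_def)
    then have legr: "signed_leg a r = z"
      using q by (simp add: abs_mult mult_sgn_abs flip: mult.assoc)
    have "z \<in> Z"
      using i by (auto simp: Z_def z)
    then have "simple_zero (averaged_fun a f (\<lambda>x y. 0)) r"
      using simple_zero_at_simple_root[OF F r] root poly_pderiv_prod_linear_root[OF Z(1)]
      by (simp add: legr P_def)
    then have "r \<in> L"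
      using r by (simp add: L_def averaging_limit_cycles_def)
    then show "z \<in> signed_leg a ` L"
      using legr by blast
  qed
  \<comment> \<open>Comparing cardinalities through the image needs finiteness of \<open>L\<close>,
    supplied by the upper bound.\<close>
  moreover have "finite L"
    using averaging_limit_cycles_bound[OF a f poly2_le_zero] by (simp add: L_def)
  ultimately have "card (\<rho> ` {1..n}) \<le> card L"
    by (rule surj_card_le[rotated])
  then have "n \<le> card L"
    by (simp add: card_image inj_on_subset[OF inj subset_UNIV])
  then show ?thesis
    using f by (auto simp: L_def)
qed

theorem theorem1p2:
  fixes a :: real and n :: nat
  assumes "a \<noteq> 0" and "n \<ge> 1"
  shows "(\<forall>f \<in> poly2_le n. \<forall>g \<in> poly2_le n.
            finite (averaging_limit_cycles a f g) \<and> card (averaging_limit_cycles a f g) \<le> n)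
       \<and> (\<exists>f \<in> poly2_le n. \<exists>g \<in> poly2_le n.
            finite (averaging_limit_cycles a f g) \<and> card (averaging_limit_cycles a f g) = n)"
proof (intro conjI ballI)
  obtain f where "f \<in> poly2_le n" "n \<le> card (averaging_limit_cycles a f (\<lambda>x y. 0))"
    using exists_averaging_limit_cycles[OF assms(1)] by blast
  then show "\<exists>f \<in> poly2_le n. \<exists>g \<in> poly2_le n.
      finite (averaging_limit_cycles a f g) \<and> card (averaging_limit_cycles a f g) = n"
    \<comment> \<open>With g = 0, the general bound turns "at least n" into "exactly n".\<close>
    using averaging_limit_cycles_bound[OF assms(1) _ poly2_le_zero] poly2_le_zero
    by (meson le_antisym)
qed (use averaging_limit_cycles_bound[OF assms(1)] in auto)

end
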